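(* Let $V$ be a vector space over $\mathbb{R}$ endowed with a norm $\|\cdot\|$, with dual space $V^*$, and suppose that $\mu$ is a Borel measure on $V^*$ such that $$\|x\|=\int_{V^*}|x\ell|\,\mu(\mathrm{d}\ell)\quad\text{for all }x\in V.$$ Let $x_1,\dots,x_n$ be any vectors in $V$ and let $\varepsilon_1,\dots,\varepsilon_n$ be independent Rademacher random variables. Then $$\Big(\int_{V^*}\sqrt{\sum_{i=1}^n(x_i\ell)^2}\,\mu(\mathrm{d}\ell)\Big)^2\ge\mathsf{E}\Big\|\sum_{i=1}^n\varepsilon_i x_i\Big\|^2.$$
   Context: For $x\in V$ and $\ell\in V^*$, $x\ell$ denotes the value of the linear functional $\ell$ at $x$. A Rademacher random variable $\varepsilon$ satisfies $\mathsf{P}(\varepsilon=1)=\mathsf{P}(\varepsilon=-1)=\frac12$. $\mathsf{E}$ denotes expectation. *)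

theory Defs
  imports "HOL-Probability.Probability"
begin

definition borel_measure_on :: "'a topology \<Rightarrow> 'a measure \<Rightarrow> bool" where
  "borel_measure_on T M \<longleftrightarrow>
     space M = topspace T \<and> sets M = sigma_sets (topspace T) {U. openin T U}"

text \<open>
  The dual of the normed space is the type \<open>'a \<Rightarrow>\<^sub>L real\<close>. The topology generating its Borel
  sets is left open, subject only to continuity of the evaluations: the two lemmas below
  show that the norm topology and the weak-* topology, which for real-valued functionals
  is the strong operator topology, are both included.
\<close>

definition dual_topology :: "('a::real_normed_vector \<Rightarrow>\<^sub>L real) topology \<Rightarrow> bool" where
  "dual_topology T \<longleftrightarrow>
     topspace T = UNIV \<and> (\<forall>x. continuous_map T euclideanreal (\<lambda>l. blinfun_apply l x))"

lemma dual_topology_norm: "dual_topology euclidean"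
  unfolding dual_topology_def by (auto intro!: continuous_intros)

lemma dual_topology_weak_star: "dual_topology strong_operator_topology"
  unfolding dual_topology_def
  by (simp add: strong_operator_topology_topspace strong_operator_topology_continuous_evaluation)

lemma borel_measure_on_euclidean:
  fixes M :: "'a::topological_space measure"
  shows "borel_measure_on euclidean M \<longleftrightarrow> sets M = sets borel"
proof -
  have "sets (borel :: 'a measure) = sigma_sets UNIV {U. open U}"
    by (simp add: borel_def)
  moreover have "sets M = sets borel \<Longrightarrow> space M = UNIV"
    using sets_eq_imp_space_eq[of M borel] by simp
  ultimately show ?thesis
    by (auto simp: borel_measure_on_def)
qed

definition rademacher :: "'b measure \<Rightarrow> ('b \<Rightarrow> real) \<Rightarrow> bool" where
  "rademacher P X \<longleftrightarrow>
     X \<in> borel_measurable P \<and>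
     measure P {\<omega> \<in> space P. X \<omega> = 1} = 1 / 2 \<and>
     measure P {\<omega> \<in> space P. X \<omega> = - 1} = 1 / 2"

end

theory Submission
  imports Defs
begin

text \<open>
  The inequality is Minkowski's integral inequality
  \<open>\<parallel>\<integral> |S l| d\<mu>\<parallel>\<^sub>2 \<le> \<integral> \<parallel>S l\<parallel>\<^sub>2 d\<mu>\<close>
  for the random vector \<open>S = \<Sum>\<epsilon>\<^sub>i x\<^sub>i\<close>: the left-hand side is the \<open>L\<^sup>2\<close>
  norm of \<open>\<parallel>S\<parallel>\<close> by the representation of the norm, and on the right
  \<open>E (S l)\<^sup>2 = \<Sum>(x\<^sub>i l)\<^sup>2\<close> because independent signs are orthonormal.

  Nothing makes \<open>\<mu>\<close> \<open>\<sigma>\<close>-finite, so Fubini's theorem is not available on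
  \<open>P \<Otimes> \<mu>\<close>. Instead, \<open>\<epsilon>\<close> almost surely takes one of the finitely many values
  in \<open>{-1, 1}\<^sup>n\<close>, so that expectations are finite weighted sums
  (lemma \<open>expectation_signs\<close>) and Minkowski's inequality is needed only for these
  (lemma \<open>Minkowski_nn_integral_weighted\<close>).
\<close>

text \<open>
  With \<open>A\<close> and \<open>R\<close> the two sides before squaring, write one factor of
  \<open>(N s)\<^sup>2\<close> as an integral and apply the Cauchy--Schwarz inequality pointwise:
  \<open>A\<^sup>2 = \<integral> (\<Sum>s. p s * N s * |h s|) d\<mu> \<le> A * R\<close>. The finite number \<open>A\<close> cancels.
\<close>

lemma Minkowski_nn_integral_weighted:
  fixes p N :: "'s \<Rightarrow> real" and h :: "'s \<Rightarrow> 'l \<Rightarrow> real"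
  assumes F: "finite F" and p: "\<And>s. s \<in> F \<Longrightarrow> p s \<ge> 0" and N0: "\<And>s. s \<in> F \<Longrightarrow> N s \<ge> 0"
    and h[measurable]: "\<And>s. s \<in> F \<Longrightarrow> h s \<in> borel_measurable M"
    and N: "\<And>s. s \<in> F \<Longrightarrow> ennreal (N s) = (\<integral>\<^sup>+ l. ennreal \<bar>h s l\<bar> \<partial>M)"
  shows "ennreal (\<Sum>s\<in>F. p s * (N s)\<^sup>2) \<le> (\<integral>\<^sup>+ l. ennreal (sqrt (\<Sum>s\<in>F. p s * (h s l)\<^sup>2)) \<partial>M)\<^sup>2"
proof -
  define A where "A = sqrt (\<Sum>s\<in>F. p s * (N s)\<^sup>2)"
  define R where "R = (\<integral>\<^sup>+ l. ennreal (sqrt (\<Sum>s\<in>F. p s * (h s l)\<^sup>2)) \<partial>M)"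
  have sum0: "(\<Sum>s\<in>F. p s * (N s)\<^sup>2) \<ge> 0"
    using p by (intro sum_nonneg) auto
  then have A0: "A \<ge> 0" and AA: "A * A = (\<Sum>s\<in>F. p s * (N s)\<^sup>2)"
    by (auto simp: A_def)
  have CS: "(\<Sum>s\<in>F. p s * N s * \<bar>h s l\<bar>) \<le> A * sqrt (\<Sum>s\<in>F. p s * (h s l)\<^sup>2)" for l
  proof -
    have "(\<Sum>s\<in>F. p s * N s * \<bar>h s l\<bar>)
        = (\<Sum>s\<in>F. \<bar>sqrt (p s) * N s\<bar> * \<bar>sqrt (p s) * h s l\<bar>)"
      using p N0 by (intro sum.cong) (auto simp: abs_mult)
    also have "\<dots> \<le> L2_set (\<lambda>s. sqrt (p s) * N s) F * L2_set (\<lambda>s. sqrt (p s) * h s l) F"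
      by (rule L2_set_mult_ineq)
    also have "\<dots> = A * sqrt (\<Sum>s\<in>F. p s * (h s l)\<^sup>2)"
      unfolding L2_set_def A_def using p by (simp add: power_mult_distrib)
    finally show ?thesis .
  qed
  have "ennreal A * ennreal A = (\<Sum>s\<in>F. ennreal (p s * N s) * ennreal (N s))"
    using A0 p N0 by (simp add: AA sum_ennreal flip: ennreal_mult)
       (simp add: power2_eq_square mult.assoc)
  also have "\<dots> = (\<Sum>s\<in>F. \<integral>\<^sup>+ l. ennreal (p s * N s) * ennreal \<bar>h s l\<bar> \<partial>M)"
    by (intro sum.cong refl) (simp add: N nn_integral_cmult)
  also have "\<dots> = (\<integral>\<^sup>+ l. (\<Sum>s\<in>F. ennreal (p s * N s) * ennreal \<bar>h s l\<bar>) \<partial>M)"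
    by (intro nn_integral_sum[symmetric]) measurable
  also have "\<dots> = (\<integral>\<^sup>+ l. ennreal (\<Sum>s\<in>F. p s * N s * \<bar>h s l\<bar>) \<partial>M)"
    using p N0 by (intro nn_integral_cong) (simp add: sum_ennreal flip: ennreal_mult)
  also have "\<dots> \<le> (\<integral>\<^sup>+ l. ennreal A * ennreal (sqrt (\<Sum>s\<in>F. p s * (h s l)\<^sup>2)) \<partial>M)"
    using A0 p CS by (intro nn_integral_mono) (simp add: ennreal_leI sum_nonneg flip: ennreal_mult)
  also have "\<dots> = ennreal A * R"
    unfolding R_def by (intro nn_integral_cmult) measurable
  finally have "ennreal A * ennreal A \<le> ennreal A * R" .
  then have "ennreal A \<le> R"
    using A0 by (cases "A = 0") (auto simp: ennreal_mult_le_mult_iff)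
  then have "(ennreal A)\<^sup>2 \<le> R\<^sup>2"
    by (intro power_mono) auto
  moreover have "(ennreal A)\<^sup>2 = ennreal (\<Sum>s\<in>F. p s * (N s)\<^sup>2)"
    using A0 sum0 by (simp add: ennreal_power A_def)
  ultimately show ?thesis
    by (simp add: R_def)
qed

lemma rademacher_AE:
  assumes "prob_space P" "rademacher P X"
  shows "AE \<omega> in P. X \<omega> \<in> {-1, 1}"
proof -
  interpret prob_space P by fact
  have [measurable]: "X \<in> borel_measurable P"
    using assms by (simp add: rademacher_def)
  have "prob {\<omega> \<in> space P. X \<omega> \<in> {-1, 1}}
      = prob ({\<omega> \<in> space P. X \<omega> = 1} \<union> {\<omega> \<in> space P. X \<omega> = -1})"
    by (rule arg_cong[where f = prob]) auto
  also have "\<dots> = 1"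
    using assms(2) by (subst finite_measure_Union) (auto simp: rademacher_def)
  finally show ?thesis
    by (subst (asm) prob_Collect_eq_1) auto
qed

lemma rademacher_expectation:
  assumes "prob_space P" "rademacher P X"
  shows "prob_space.expectation P X = 0"
proof -
  interpret prob_space P by fact
  have [measurable]: "X \<in> borel_measurable P"
    using assms by (simp add: rademacher_def)
  let ?A = "\<lambda>c. {\<omega> \<in> space P. X \<omega> = c}"
  have "expectation X = expectation (\<lambda>\<omega>. indicator (?A 1) \<omega> - indicator (?A (-1)) \<omega>)"
    using rademacher_AE[OF assms] by (intro integral_cong_AE) (auto simp: indicator_def)
  also have "\<dots> = 0"
    using assms(2)
    by (subst Bochner_Integration.integral_diff) (auto simp: rademacher_def less_top[symmetric])
  finally show ?thesis .
qed

text \<open>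
  Prescribing the value \<open>0\<close> outside \<open>I\<close> makes this set finite within the type of all
  sequences, which carries the topology needed below.
\<close>

definition sign_vectors :: "nat set \<Rightarrow> (nat \<Rightarrow> real) set" where
  "sign_vectors I = {s. (\<forall>i\<in>I. s i \<in> {-1, 1}) \<and> (\<forall>i. i \<notin> I \<longrightarrow> s i = 0)}"

lemma finite_sign_vectors:
  assumes "finite I"
  shows "finite (sign_vectors I)"
proof -
  have "finite {s. \<forall>i. (i \<in> I \<longrightarrow> s i \<in> {-1, 1::real}) \<and> (i \<notin> I \<longrightarrow> s i = 0)}"
    using assms by (intro finite_set_of_finite_funs) auto
  then show ?thesis
    by (rule rev_finite_subset) (auto simp: sign_vectors_def)
qed

text \<open>
  The integrand agrees almost surely with a simple function of the signs. A Bochner integral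
  is only insensitive to null sets for measurable integrands, whence the continuity of \<open>G\<close>:
  it yields measurability because the sequence space is second countable, whereas a random
  vector in a non-separable normed space through which \<open>G\<close> factors would be hard to measure.
\<close>

lemma expectation_signs:
  fixes G :: "(nat \<Rightarrow> real) \<Rightarrow> real"
  assumes P: "prob_space P" and I: "finite I" and rad: "\<And>i. i \<in> I \<Longrightarrow> rademacher P (\<epsilon> i)"
    and G: "continuous_on UNIV G"
  shows "prob_space.expectation P (\<lambda>\<omega>. G (\<lambda>i. if i \<in> I then \<epsilon> i \<omega> else 0))
    = (\<Sum>s\<in>sign_vectors I. measure P {\<omega> \<in> space P. \<forall>i\<in>I. \<epsilon> i \<omega> = s i} * G s)"
proof -
  interpret prob_space P by fact
  define F where "F = sign_vectors I"
  have F: "finite F"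
    unfolding F_def using I by (rule finite_sign_vectors)
  define W where "W = (\<lambda>\<omega> i. if i \<in> I then \<epsilon> i \<omega> else 0)"
  have \<epsilon>[measurable]: "i \<in> I \<Longrightarrow> \<epsilon> i \<in> borel_measurable P" for i
    using rad by (simp add: rademacher_def)
  have "W \<in> borel_measurable P"
    unfolding W_def
  proof (rule measurable_coordinatewise_then_product)
    show "(\<lambda>\<omega>. if i \<in> I then \<epsilon> i \<omega> else 0) \<in> borel_measurable P" for i
      by (cases "i \<in> I") auto
  qed
  then have GW: "(\<lambda>\<omega>. G (W \<omega>)) \<in> borel_measurable P"
    using borel_measurable_continuous_onI[OF G] by (rule measurable_compose)
  let ?A = "\<lambda>s. {\<omega> \<in> space P. \<forall>i\<in>I. \<epsilon> i \<omega> = s i}"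
  have A: "?A s \<in> events" for s
    using I by measurable
  have "AE \<omega> in P. \<forall>i\<in>I. \<epsilon> i \<omega> \<in> {-1, 1}"
    using I rad rademacher_AE[OF P] by (subst AE_finite_all) auto
  then have "AE \<omega> in P. G (W \<omega>) = (\<Sum>s\<in>F. indicator (?A s) \<omega> * G s)"
    using AE_space
  proof eventually_elim
    case (elim \<omega>)
    then have "W \<omega> \<in> F"
      by (auto simp: W_def F_def sign_vectors_def)
    have ind: "indicator (?A s) \<omega> = (if s = W \<omega> then 1 else 0 :: real)" if "s \<in> F" for s
    proof -
      have "(\<forall>i\<in>I. \<epsilon> i \<omega> = s i) \<longleftrightarrow> s = W \<omega>"
        using that by (auto simp: W_def F_def sign_vectors_def fun_eq_iff)
      then show ?thesis
        using elim by (simp add: indicator_def)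
    qed
    have "(\<Sum>s\<in>F. indicator (?A s) \<omega> * G s) = (\<Sum>s\<in>F. if s = W \<omega> then G s else 0)"
      by (intro sum.cong) (auto simp: ind)
    then show ?case
      using F \<open>W \<omega> \<in> F\<close> by simp
  qed
  then have "expectation (\<lambda>\<omega>. G (W \<omega>)) = expectation (\<lambda>\<omega>. \<Sum>s\<in>F. indicator (?A s) \<omega> * G s)"
    using GW A by (intro integral_cong_AE) auto
  also have "\<dots> = (\<Sum>s\<in>F. prob (?A s) * G s)"
    using A by (subst Bochner_Integration.integral_sum) (auto simp: less_top[symmetric])
  finally show ?thesis
    by (simp add: W_def F_def)
qed

lemma expectation_rademacher_sum_power2:
  fixes a :: "nat \<Rightarrow> real"
  assumes P: "prob_space P" and I: "finite I" and rad: "\<And>i. i \<in> I \<Longrightarrow> rademacher P (\<epsilon> i)"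
    and ind: "prob_space.indep_vars P (\<lambda>_. borel) \<epsilon> I"
  shows "prob_space.expectation P (\<lambda>\<omega>. (\<Sum>i\<in>I. \<epsilon> i \<omega> * a i)\<^sup>2) = (\<Sum>i\<in>I. (a i)\<^sup>2)"
proof -
  interpret prob_space P by fact
  have \<epsilon>[measurable]: "i \<in> I \<Longrightarrow> \<epsilon> i \<in> borel_measurable P" for i
    using rad by (simp add: rademacher_def)
  have AE: "AE \<omega> in P. \<epsilon> i \<omega> \<in> {-1, 1}" if "i \<in> I" for i
    using rademacher_AE[OF P rad[OF that]] .
  have int1: "integrable P (\<epsilon> i)" if "i \<in> I" for i
    using that AE[OF that] by (intro integrable_const_bound[where B = 1]) auto
  have int2: "integrable P (\<lambda>\<omega>. \<epsilon> i \<omega> * \<epsilon> j \<omega>)" if ij: "i \<in> I" "j \<in> I" for i j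
  proof (rule integrable_const_bound[where B = 1])
    show "AE \<omega> in P. norm (\<epsilon> i \<omega> * \<epsilon> j \<omega>) \<le> 1"
      using AE[OF ij(1)] AE[OF ij(2)] by eventually_elim auto
  qed (use ij in auto)
  have orth: "expectation (\<lambda>\<omega>. \<epsilon> i \<omega> * \<epsilon> j \<omega>) = (if i = j then 1 else 0)"
    if ij: "i \<in> I" "j \<in> I" for i j
  proof (cases "i = j")
    case True
    have "expectation (\<lambda>\<omega>. \<epsilon> i \<omega> * \<epsilon> i \<omega>) = expectation (\<lambda>_. 1)"
      using AE[OF ij(1)] ij by (intro integral_cong_AE) auto
    then show ?thesis
      using True by (simp add: prob_space)
  next
    case False
    have "expectation (\<lambda>\<omega>. \<epsilon> i \<omega> * \<epsilon> j \<omega>) = expectation (\<epsilon> i) * expectation (\<epsilon> j)"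
      using indep_vars_lebesgue_integral[of "{i, j}" \<epsilon>] indep_vars_subset[OF ind, of "{i, j}"]
        int1 ij False by auto
    then show ?thesis
      using False rademacher_expectation[OF P rad[OF ij(1)]] by simp
  qed
  have "expectation (\<lambda>\<omega>. (\<Sum>i\<in>I. \<epsilon> i \<omega> * a i)\<^sup>2)
      = expectation (\<lambda>\<omega>. \<Sum>i\<in>I. \<Sum>j\<in>I. (a i * a j) * (\<epsilon> i \<omega> * \<epsilon> j \<omega>))"
    by (simp add: power2_eq_square sum_product mult_ac)
  also have "\<dots> = (\<Sum>i\<in>I. \<Sum>j\<in>I. (a i * a j) * expectation (\<lambda>\<omega>. \<epsilon> i \<omega> * \<epsilon> j \<omega>))"
    using int2 by simp
  also have "\<dots> = (\<Sum>i\<in>I. \<Sum>j\<in>I. if i = j then a i * a j else 0)"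
    by (intro sum.cong) (auto simp: orth)
  also have "\<dots> = (\<Sum>i\<in>I. (a i)\<^sup>2)"
    using I by (simp add: power2_eq_square)
  finally show ?thesis .
qed

text \<open>
  This is the only place where the topology on the dual enters: its Borel sets make
  evaluations measurable.
\<close>

lemma borel_measurable_evaluation:
  assumes "dual_topology T" "borel_measure_on T \<mu>"
  shows "(\<lambda>l. blinfun_apply l v) \<in> borel_measurable \<mu>"
proof (rule borel_measurableI)
  fix S :: "real set" assume "open S"
  have "space \<mu> = UNIV" "topspace T = UNIV"
    using assms by (auto simp: dual_topology_def borel_measure_on_def)
  moreover have "openin T {l \<in> topspace T. blinfun_apply l v \<in> S}"
    using assms(1) \<open>open S\<close> by (intro openin_continuous_map_preimage[where Y = euclideanreal])
      (auto simp: dual_topology_def)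
  ultimately show "(\<lambda>l. blinfun_apply l v) -` S \<inter> space \<mu> \<in> sets \<mu>"
    using assms(2) by (auto simp: borel_measure_on_def vimage_def intro: sigma_sets.Basic)
qed

theorem mainTheorem6:
  fixes T :: "('a::real_normed_vector \<Rightarrow>\<^sub>L real) topology"
    and \<mu> :: "('a \<Rightarrow>\<^sub>L real) measure"
    and P :: "'b measure"
    and \<epsilon> :: "nat \<Rightarrow> 'b \<Rightarrow> real"
    and x :: "nat \<Rightarrow> 'a"
    and n :: nat
  assumes "dual_topology T"
    and "borel_measure_on T \<mu>"
    and "\<And>v. ennreal (norm v) = (\<integral>\<^sup>+ l. ennreal \<bar>blinfun_apply l v\<bar> \<partial>\<mu>)"
    and "prob_space P"
    and "\<And>i. i \<in> {1..n} \<Longrightarrow> rademacher P (\<epsilon> i)"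
    and "prob_space.indep_vars P (\<lambda>_. borel) \<epsilon> {1..n}"
  shows "(\<integral>\<^sup>+ l. ennreal (sqrt (\<Sum>i=1..n. (blinfun_apply l (x i))\<^sup>2)) \<partial>\<mu>)\<^sup>2
    \<ge> ennreal (prob_space.expectation P (\<lambda>\<omega>. (norm (\<Sum>i=1..n. \<epsilon> i \<omega> *\<^sub>R x i))\<^sup>2))"
proof -
  define F where "F = sign_vectors {1..n}"
  define p where "p s = measure P {\<omega> \<in> space P. \<forall>i\<in>{1..n}. \<epsilon> i \<omega> = s i}" for s
  define v where "v s = (\<Sum>i=1..n. s i *\<^sub>R x i)" for s :: "nat \<Rightarrow> real"
  have signs: "prob_space.expectation P (\<lambda>\<omega>. G (\<lambda>i. if i \<in> {1..n} then \<epsilon> i \<omega> else 0))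
      = (\<Sum>s\<in>F. p s * G s)" if "continuous_on UNIV G" for G
    unfolding F_def p_def
    by (rule expectation_signs[OF assms(4) finite_atLeastAtMost assms(5) that])
  have F: "finite F"
    unfolding F_def by (simp add: finite_sign_vectors)
  have v: "continuous_on UNIV v"
    unfolding v_def by (intro continuous_intros continuous_on_product_coordinates)
  have v_restrict: "v (\<lambda>i. if i \<in> {1..n} then \<epsilon> i \<omega> else 0) = (\<Sum>i=1..n. \<epsilon> i \<omega> *\<^sub>R x i)" for \<omega>
    unfolding v_def by (intro sum.cong) auto
  have lv: "continuous_on UNIV (\<lambda>s. blinfun_apply l (v s))" for l
    using v by (intro continuous_intros)
  have norm_v: "prob_space.expectation P (\<lambda>\<omega>. (norm (\<Sum>i=1..n. \<epsilon> i \<omega> *\<^sub>R x i))\<^sup>2)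
      = (\<Sum>s\<in>F. p s * (norm (v s))\<^sup>2)"
    using signs[where G = "\<lambda>s. (norm (v s))\<^sup>2"] v
    unfolding v_restrict by (simp add: continuous_intros)
  have eval_v: "(\<Sum>s\<in>F. p s * (blinfun_apply l (v s))\<^sup>2) = (\<Sum>i=1..n. (blinfun_apply l (x i))\<^sup>2)" for l
    using signs[where G = "\<lambda>s. (blinfun_apply l (v s))\<^sup>2"] lv[of l]
      expectation_rademacher_sum_power2[OF assms(4) _ assms(5,6), of "\<lambda>i. blinfun_apply l (x i)"]
    unfolding v_restrict
    by (simp add: blinfun.sum_right blinfun.scaleR_right continuous_intros)
  have "p s \<ge> 0" for s
    by (simp add: p_def)
  then show ?thesis
    using Minkowski_nn_integral_weighted[OF F, of p "\<lambda>s. norm (v s)" "\<lambda>s l. blinfun_apply l (v s)" \<mu>]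
      borel_measurable_evaluation[OF assms(1,2)] assms(3)
    unfolding norm_v eval_v by simp
qed

end
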